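(* Let $\gamma\equiv\gamma^{(2n)}=\{\gamma_{ij}\}_{i,j\in\mathbb{Z}_+^d,\;|i|+|j|\le 2n}$ be a complex sequence, and assume that its moment matrix $M(n)\equiv M^d(n)(\gamma)$ is positive semidefinite and admits a flat extension $M(n+1)$. Let $M(n+2)$ be the unique flat moment matrix extension of $M(n+1)$. Then $\mathcal{V}(M(n+2))=\mathcal{V}(M(n+1))$.
   Context: $\mathbb{C}_l^d[z,\bar z]$ is the space of complex polynomials of total degree $\le l$ in $z=(z_1,\dots,z_d)$, $\bar z=(\bar z_1,\dots,\bar z_d)$, with basis the monomials $\bar z^iz^j$, $|i|+|j|\le l$ ($i,j\in\mathbb{Z}_+^d$, $|i|=i_1+\dots+i_d$); $\hat f$ is the coefficient vector of $f$ in this basis. For a complex sequence $\gamma^{(2l)}$, the Riesz functional is $\Lambda_\gamma(\sum b_{rs}\bar z^rz^s)=\sum b_{rs}\gamma_{rs}$ on $\mathbb{C}^d_{2l}[z,\bar z]$, and the moment matrix $M(l)=M^d(l)(\gamma)$ is the square matrix with rows and columns indexed by the monomials of degree $\le l$ determined by $\langle M^d(l)(\gamma)\hat f,\hat g\rangle=\Lambda_\gamma(f\bar g)$, $f,g\in\mathbb{C}_l^d[z,\bar z]$. The column indexed by $\bar z^iz^j$ is denoted $\bar Z^iZ^j$, and for $p=\sum a_{rs}\bar z^rz^s\in\mathbb{C}_l^d[z,\bar z]$, $p(Z,\bar Z):=\sum a_{rs}\bar Z^rZ^s$. The variety is $\mathcal{V}(M(l)):=\bigcap\{\mathcal{Z}(p):p\in\mathbb{C}_l^d[z,\bar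 z],\ p(Z,\bar Z)=0\}$, with $\mathcal{Z}(p)=\{z\in\mathbb{C}^d:p(z,\bar z)=0\}$. A flat extension $M(l+1)$ of a positive semidefinite moment matrix $M(l)$ is a positive semidefinite moment matrix $M(l+1)$ of a sequence of degree $2l+2$ extending the given one, with $\operatorname{rank}M(l+1)=\operatorname{rank}M(l)$. It is known that if $M(n)\ge0$ has a flat extension $M(n+1)$, then $M(n+1)$ has a unique flat moment matrix extension $M(n+2)$. *)

theory Defs
  imports "HOL-Analysis.Analysis" "HOL-Library.Poly_Mapping" "HOL-Library.Function_Algebras"
begin

text \<open>
  The number \<open>d\<close> of variables is \<open>CARD('d)\<close>.  The pair \<open>(i, j)\<close> of multi-indices stands for the
  monomial \<open>(cnj z)\<^sup>i z\<^sup>j\<close>, the power of the conjugate coming first.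
  With the componentwise addition of exponents, the
  finitely supported functions on these pairs form the polynomial ring in \<open>z\<close>, \<open>cnj z\<close>,
  and \<open>Poly_Mapping.lookup f\<close> is the coefficient vector of \<open>f\<close>.
\<close>

type_synonym 'd mono = "(nat ^ 'd) \<times> (nat ^ 'd)"
type_synonym 'd cpoly = "'d mono \<Rightarrow>\<^sub>0 complex"
type_synonym 'd cmat = "'d mono \<Rightarrow> 'd mono \<Rightarrow> complex"

definition mdeg :: "'d::finite mono \<Rightarrow> nat" where
  "mdeg m = (\<Sum>k\<in>UNIV. fst m $ k) + (\<Sum>k\<in>UNIV. snd m $ k)"

definition monoms :: "nat \<Rightarrow> 'd::finite mono set" where
  "monoms l = {m. mdeg m \<le> l}"

definition polys :: "nat \<Rightarrow> 'd::finite cpoly set" where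
  "polys l = {p. Poly_Mapping.keys p \<subseteq> monoms l}"

definition mono_eval :: "'d::finite mono \<Rightarrow> complex ^ 'd::finite \<Rightarrow> complex" where
  "mono_eval m z = (\<Prod>k\<in>UNIV. cnj (z $ k) ^ (fst m $ k)) * (\<Prod>k\<in>UNIV. (z $ k) ^ (snd m $ k))"

definition poly_eval :: "'d::finite cpoly \<Rightarrow> complex ^ 'd::finite \<Rightarrow> complex" where
  "poly_eval p z = (\<Sum>m\<in>Poly_Mapping.keys p. Poly_Mapping.lookup p m * mono_eval m z)"

definition zero_set :: "'d::finite cpoly \<Rightarrow> (complex ^ 'd::finite) set" where
  "zero_set p = {z. poly_eval p z = 0}"

text \<open>Conjugation of a polynomial conjugates the coefficients and interchanges \<open>z\<close> and \<open>cnj z\<close>.\<close>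

definition conj_poly :: "'d::finite cpoly \<Rightarrow> 'd::finite cpoly" where
  "conj_poly p = Poly_Mapping.map_key prod.swap (Poly_Mapping.map cnj p)"

text \<open>
  A truncated sequence of degree \<open>2 * l\<close> is represented by a total function of which only the
  values on \<^term>\<open>monoms (2 * l)\<close> matter.
\<close>

definition riesz :: "('d::finite mono \<Rightarrow> complex) \<Rightarrow> 'd::finite cpoly \<Rightarrow> complex" where
  "riesz \<gamma> p = (\<Sum>m\<in>Poly_Mapping.keys p. Poly_Mapping.lookup p m * \<gamma> m)"

text \<open>
  Matrices with rows and columns indexed by \<^term>\<open>monoms l\<close> are functions \<open>A r c\<close> of the row
  index \<open>r\<close> and the column index \<open>c\<close> which vanish outside \<^term>\<open>monoms l\<close>.
\<close>

definition vinner :: "nat \<Rightarrow> ('d::finite mono \<Rightarrow> complex) \<Rightarrow> ('d::finite mono \<Rightarrow> complex) \<Rightarrow> complex" where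
  "vinner l u v = (\<Sum>r\<in>monoms l. u r * cnj (v r))"

definition mvec :: "nat \<Rightarrow> 'd::finite cmat \<Rightarrow> ('d::finite mono \<Rightarrow> complex) \<Rightarrow> 'd::finite mono \<Rightarrow> complex" where
  "mvec l A v = (\<lambda>r. \<Sum>c\<in>monoms l. A r c * v c)"

text \<open>
  The entries are forced by the identity \<open>\<langle>M f, g\<rangle> = \<Lambda> (f * conj g)\<close> applied to monomials;
  \<open>moment_matrix_inner\<close> and \<open>moment_matrix_unique\<close> below show that this identity holds for all
  polynomials of degree at most \<open>l\<close> and determines the matrix.
\<close>

definition moment_matrix :: "nat \<Rightarrow> ('d::finite mono \<Rightarrow> complex) \<Rightarrow> 'd::finite cmat" where
  "moment_matrix l \<gamma> r c =
     (if r \<in> monoms l \<and> c \<in> monoms l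
      then riesz \<gamma> (Poly_Mapping.single c 1 * conj_poly (Poly_Mapping.single r 1)) else 0)"

text \<open>Over the complex numbers this condition forces the matrix to be Hermitian.\<close>

definition psd :: "nat \<Rightarrow> 'd::finite cmat \<Rightarrow> bool" where
  "psd l A \<longleftrightarrow> (\<forall>v. vinner l (mvec l A v) v \<in> \<real>\<^sub>\<ge>\<^sub>0)"

definition fscale :: "complex \<Rightarrow> ('a \<Rightarrow> complex) \<Rightarrow> 'a \<Rightarrow> complex" where
  "fscale a v = (\<lambda>x. a * v x)"

interpretation cfun: vector_space fscale
  by unfold_locales (auto simp: fscale_def fun_eq_iff algebra_simps)

definition col :: "'d::finite cmat \<Rightarrow> 'd::finite mono \<Rightarrow> 'd::finite mono \<Rightarrow> complex" where
  "col A c = (\<lambda>r. A r c)"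

definition mrank :: "nat \<Rightarrow> 'd::finite cmat \<Rightarrow> nat" where
  "mrank l A = cfun.dim (cfun.span (col A ` monoms l))"

text \<open>The column combination \<open>p(Z, Z')\<close>, where \<open>Z'\<close> is the conjugate of \<open>Z\<close>.\<close>

definition poly_col :: "nat \<Rightarrow> 'd::finite cmat \<Rightarrow> 'd::finite cpoly \<Rightarrow> 'd::finite mono \<Rightarrow> complex" where
  "poly_col l A p = (\<Sum>c\<in>monoms l. fscale (Poly_Mapping.lookup p c) (col A c))"

definition variety :: "nat \<Rightarrow> 'd::finite cmat \<Rightarrow> (complex ^ 'd::finite) set" where
  "variety l A = \<Inter> {zero_set p |p. p \<in> polys l \<and> poly_col l A p = 0}"

definition flat_extension ::
    "nat \<Rightarrow> ('d::finite mono \<Rightarrow> complex) \<Rightarrow> ('d::finite mono \<Rightarrow> complex) \<Rightarrow> bool" where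
  "flat_extension l \<gamma> \<gamma>' \<longleftrightarrow>
     (\<forall>m\<in>monoms (2 * l). \<gamma>' m = \<gamma> m) \<and>
     psd (l + 1) (moment_matrix (l + 1) \<gamma>') \<and>
     mrank (l + 1) (moment_matrix (l + 1) \<gamma>') = mrank l (moment_matrix l \<gamma>)"

lemma finite_monoms [simp]: "finite (monoms l :: 'd::finite mono set)"
proof -
  let ?V = "vec_lambda ` (Pi\<^sub>E UNIV (\<lambda>_. {..l})) :: (nat ^ 'd) set"
  have fin: "finite ?V"
    by (intro finite_imageI finite_PiE) auto
  have mem: "v \<in> ?V" if "(\<Sum>k\<in>UNIV. v $ k) \<le> l" for v :: "nat ^ 'd"
  proof -
    have "v $ k \<le> l" for k
      using member_le_sum[of k UNIV "\<lambda>k. v $ k"] that by simp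
    then have "vec_nth v \<in> Pi\<^sub>E UNIV (\<lambda>_. {..l})" by auto
    then show ?thesis by (metis image_eqI vec_lambda_eta vec_nth_inverse)
  qed
  have "monoms l \<subseteq> ?V \<times> ?V"
    by (auto simp: monoms_def mdeg_def intro!: mem)
  then show ?thesis using fin finite_subset by blast
qed

lemma lookup_conj_poly:
  "Poly_Mapping.lookup (conj_poly p) m = cnj (Poly_Mapping.lookup p (prod.swap m))"
  by (simp add: conj_poly_def map_key.rep_eq[OF inj_swap] Poly_Mapping.map.rep_eq when_def)

lemma conj_poly_single:
  "conj_poly (Poly_Mapping.single m a) = Poly_Mapping.single (prod.swap m) (cnj a)"
  by (rule poly_mapping_eqI) (cases m, auto simp: lookup_conj_poly lookup_single when_def)

lemma conj_poly_add: "conj_poly (p + q) = conj_poly p + conj_poly q"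
  by (rule poly_mapping_eqI) (simp add: lookup_conj_poly lookup_add)

lemma conj_poly_sum: "conj_poly (\<Sum>i\<in>I. f i) = (\<Sum>i\<in>I. conj_poly (f i))"
proof -
  have "conj_poly 0 = 0"
    by (rule poly_mapping_eqI) (simp add: lookup_conj_poly)
  then show ?thesis
    by (induction I rule: infinite_finite_induct) (simp_all add: conj_poly_add)
qed

lemma riesz_superset:
  assumes "finite S" "Poly_Mapping.keys p \<subseteq> S"
  shows "riesz \<gamma> p = (\<Sum>m\<in>S. Poly_Mapping.lookup p m * \<gamma> m)"
  unfolding riesz_def using assms
  by (intro sum.mono_neutral_left) (auto simp: in_keys_iff)

lemma riesz_add: "riesz \<gamma> (p + q) = riesz \<gamma> p + riesz \<gamma> q"
proof -
  let ?S = "Poly_Mapping.keys p \<union> Poly_Mapping.keys q"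
  have "Poly_Mapping.keys (p + q) \<subseteq> ?S" by (rule Poly_Mapping.keys_add)
  then show ?thesis
    by (simp add: riesz_superset[of ?S] lookup_add algebra_simps sum.distrib)
qed

lemma riesz_sum: "riesz \<gamma> (\<Sum>i\<in>I. f i) = (\<Sum>i\<in>I. riesz \<gamma> (f i))"
proof -
  have "riesz \<gamma> 0 = 0" by (simp add: riesz_def)
  then show ?thesis
    by (induction I rule: infinite_finite_induct) (simp_all add: riesz_add)
qed

lemma riesz_single: "riesz \<gamma> (Poly_Mapping.single m a) = a * \<gamma> m"
  by (simp add: riesz_def)

lemma moment_matrix_entry:
  assumes "r \<in> monoms l" "c \<in> monoms l"
  shows "moment_matrix l \<gamma> r c = \<gamma> (c + prod.swap r)"
  using assms by (simp add: moment_matrix_def conj_poly_single mult_single riesz_single)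

lemma poly_expansion:
  assumes "f \<in> polys l"
  shows "f = (\<Sum>c\<in>monoms l. Poly_Mapping.single c (Poly_Mapping.lookup f c))"
proof (rule poly_mapping_eqI)
  fix m
  have "(\<Sum>c\<in>monoms l. Poly_Mapping.lookup (Poly_Mapping.single c (Poly_Mapping.lookup f c)) m)
      = (\<Sum>c\<in>monoms l. if c = m then Poly_Mapping.lookup f m else 0)"
    by (intro sum.cong) (auto simp: lookup_single when_def)
  also have "\<dots> = Poly_Mapping.lookup f m"
    using assms by (auto simp: polys_def in_keys_iff)
  finally show "Poly_Mapping.lookup f m =
      Poly_Mapping.lookup (\<Sum>c\<in>monoms l. Poly_Mapping.single c (Poly_Mapping.lookup f c)) m"
    by (simp add: lookup_sum)
qed

lemma moment_matrix_inner:
  assumes "f \<in> polys l" "g \<in> polys l"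
  shows "vinner l (mvec l (moment_matrix l \<gamma>) (Poly_Mapping.lookup f)) (Poly_Mapping.lookup g)
       = riesz \<gamma> (f * conj_poly g)"
proof -
  let ?a = "Poly_Mapping.lookup f" and ?b = "Poly_Mapping.lookup g"
  have "f * conj_poly g = (\<Sum>c\<in>monoms l. Poly_Mapping.single c (?a c)) *
      (\<Sum>r\<in>monoms l. Poly_Mapping.single (prod.swap r) (cnj (?b r)))"
    using poly_expansion[OF assms(1)] poly_expansion[OF assms(2)]
    by (metis (no_types, lifting) conj_poly_single conj_poly_sum sum.cong)
  then have "f * conj_poly g = (\<Sum>c\<in>monoms l. \<Sum>r\<in>monoms l.
      Poly_Mapping.single (c + prod.swap r) (?a c * cnj (?b r)))"
    by (simp add: sum_product mult_single)
  then have "riesz \<gamma> (f * conj_poly g) =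
      (\<Sum>c\<in>monoms l. \<Sum>r\<in>monoms l. ?a c * cnj (?b r) * \<gamma> (c + prod.swap r))"
    by (simp add: riesz_sum riesz_single)
  also have "\<dots> = (\<Sum>r\<in>monoms l. \<Sum>c\<in>monoms l. ?a c * cnj (?b r) * \<gamma> (c + prod.swap r))"
    by (rule sum.swap)
  also have "\<dots> = (\<Sum>r\<in>monoms l. \<Sum>c\<in>monoms l. moment_matrix l \<gamma> r c * ?a c * cnj (?b r))"
    by (intro sum.cong) (auto simp: moment_matrix_entry)
  finally show ?thesis
    by (simp add: vinner_def mvec_def sum_distrib_right)
qed

lemma vinner_single:
  assumes "r \<in> monoms l" "c \<in> monoms l"
  shows "vinner l (mvec l A (Poly_Mapping.lookup (Poly_Mapping.single c 1)))
           (Poly_Mapping.lookup (Poly_Mapping.single r 1)) = A r c"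
proof -
  have "mvec l A (Poly_Mapping.lookup (Poly_Mapping.single c 1)) = (\<lambda>x. A x c)"
    using assms by (simp add: mvec_def lookup_single when_def fun_eq_iff if_distrib cong: if_cong)
  then show ?thesis
    using assms by (simp add: vinner_def lookup_single when_def if_distrib cong: if_cong)
qed

lemma moment_matrix_unique:
  fixes A :: "'d::finite cmat"
  assumes "\<And>f g. f \<in> polys l \<Longrightarrow> g \<in> polys l \<Longrightarrow>
      vinner l (mvec l A (Poly_Mapping.lookup f)) (Poly_Mapping.lookup g) = riesz \<gamma> (f * conj_poly g)"
    and "\<And>r c. r \<notin> monoms l \<or> c \<notin> monoms l \<Longrightarrow> A r c = 0"
  shows "A = moment_matrix l \<gamma>"
proof (intro ext)
  fix r c
  show "A r c = moment_matrix l \<gamma> r c"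
  proof (cases "r \<in> monoms l \<and> c \<in> monoms l")
    case True
    then have "Poly_Mapping.single c 1 \<in> polys l" "Poly_Mapping.single r 1 \<in> polys l"
      by (auto simp: polys_def)
    from assms(1)[OF this] show ?thesis
      using True by (simp add: vinner_single moment_matrix_def)
  next
    case False
    then show ?thesis using assms(2) by (auto simp: moment_matrix_def)
  qed
qed

end

theory Submission
  imports Defs
begin

text \<open>
  The kernel of \<open>M(l)\<close> is the radical of the symmetric bilinear form \<open>(p, g) \<mapsto> \<Lambda>(p g)\<close> on
  the polynomials of degree at most \<open>l\<close>.  Flatness says that every polynomial of degree at most
  \<open>l + 1\<close> is congruent, modulo the kernel of \<open>M(l + 1)\<close>, to one of degree at most \<open>l\<close>.  Hence
  \<open>ker M(n + 1) \<subseteq> ker M(n + 2)\<close>, which gives one inclusion of the varieties, and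
  \<open>x p \<in> ker M(n + 2)\<close> whenever \<open>p \<in> ker M(n + 1)\<close> and \<open>x\<close> is one of the \<open>2 d\<close> variables.
  Multiplying the congruences \<open>m \<equiv> q\<close> for monomials \<open>m\<close> of degree \<open>n + 1\<close> by variables
  therefore reduces any \<open>p \<in> ker M(n + 2)\<close> to an element of \<open>ker M(n + 1)\<close>, modulo polynomials
  that vanish on \<open>\<V>(M(n + 1))\<close>.
\<close>

section \<open>Polynomials of bounded degree, the Riesz functional and point evaluation\<close>

lemma zero_in_polys [simp]: "0 \<in> polys l"
  by (simp add: polys_def)

lemma single_in_polys: "m \<in> monoms l \<Longrightarrow> Poly_Mapping.single m a \<in> polys l"
  by (simp add: polys_def)

lemma polys_mono: "p \<in> polys k \<Longrightarrow> k \<le> l \<Longrightarrow> p \<in> polys l"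
  by (force simp: polys_def monoms_def)

lemma polys_add: "p \<in> polys l \<Longrightarrow> q \<in> polys l \<Longrightarrow> p + q \<in> polys l"
  using Poly_Mapping.keys_add[of p q] by (auto simp: polys_def)

lemma polys_diff: "p \<in> polys l \<Longrightarrow> q \<in> polys l \<Longrightarrow> p - q \<in> polys l"
  using keys_diff[of p q] by (auto simp: polys_def)

lemma polys_sum: "(\<And>i. i \<in> I \<Longrightarrow> f i \<in> polys l) \<Longrightarrow> (\<Sum>i\<in>I. f i) \<in> polys l"
  by (induction I rule: infinite_finite_induct) (auto simp: polys_add)

lemma mdeg_add: "mdeg (a + b) = mdeg a + mdeg b"
  by (simp add: mdeg_def sum.distrib)

lemma mdeg_swap: "mdeg (prod.swap m) = mdeg m"
  by (simp add: mdeg_def)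

lemma polys_mult:
  assumes "p \<in> polys k" "q \<in> polys l"
  shows "p * q \<in> polys (k + l)"
proof -
  have "mdeg m \<le> k + l" if "m \<in> Poly_Mapping.keys (p * q)" for m
  proof -
    obtain a b where "m = a + b" "a \<in> Poly_Mapping.keys p" "b \<in> Poly_Mapping.keys q"
      using keys_mult[of p q] \<open>m \<in> Poly_Mapping.keys (p * q)\<close> by blast
    moreover have "mdeg a \<le> k" "mdeg b \<le> l"
      using assms calculation by (auto simp: polys_def monoms_def)
    ultimately show ?thesis by (simp add: mdeg_add)
  qed
  then show ?thesis by (auto simp: polys_def monoms_def)
qed

text \<open>Scalars act throughout as constant polynomials \<open>Poly_Mapping.single 0 a\<close>,
  so the ring laws also cover linear combinations.\<close>

lemma polys_scale: "p \<in> polys l \<Longrightarrow> Poly_Mapping.single 0 a * p \<in> polys l"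
  using polys_mult[of "Poly_Mapping.single 0 a" 0 p l]
  by (simp add: single_in_polys monoms_def mdeg_def)

lemma poly_in_polys: "\<exists>l. p \<in> polys l"
proof
  \<comment> \<open>The sum of all degrees is a crude bound, but it also covers the zero
    polynomial.\<close>
  show "p \<in> polys (\<Sum>m\<in>Poly_Mapping.keys p. mdeg m)"
    by (auto simp: polys_def monoms_def intro: member_le_sum)
qed

lemma riesz_zero [simp]: "riesz \<gamma> 0 = 0"
  by (simp add: riesz_def)

lemma riesz_diff: "riesz \<gamma> (p - q) = riesz \<gamma> p - riesz \<gamma> q"
  using riesz_add[of \<gamma> "p - q" q] by simp

text \<open>Multiplication by a monomial shifts the sequence. With \<open>e = 0\<close> this is
  homogeneity; applied to \<open>mono_eval\<close> it makes evaluation multiplicative.\<close>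

lemma riesz_single_mult:
  "riesz \<gamma> (Poly_Mapping.single e a * p) = a * riesz (\<lambda>m. \<gamma> (e + m)) p"
proof -
  obtain l where "p \<in> polys l" using poly_in_polys by blast
  then have p: "p = (\<Sum>c\<in>monoms l. Poly_Mapping.single c (Poly_Mapping.lookup p c))"
    by (rule poly_expansion)
  have "riesz \<gamma> (Poly_Mapping.single e a * p) =
      (\<Sum>c\<in>monoms l. a * (Poly_Mapping.lookup p c * \<gamma> (e + c)))"
    by (subst p) (simp add: sum_distrib_left mult_single riesz_sum riesz_single mult.assoc)
  moreover have "riesz (\<lambda>m. \<gamma> (e + m)) p = (\<Sum>c\<in>monoms l. Poly_Mapping.lookup p c * \<gamma> (e + c))"
    by (subst p) (simp add: riesz_sum riesz_single)
  ultimately show ?thesis by (simp add: sum_distrib_left)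
qed

lemma riesz_scale: "riesz \<gamma> (Poly_Mapping.single 0 a * p) = a * riesz \<gamma> p"
  by (simp add: riesz_single_mult)

lemma riesz_cong:
  assumes "\<And>m. m \<in> monoms l \<Longrightarrow> \<gamma>' m = \<gamma> m" "p \<in> polys l"
  shows "riesz \<gamma>' p = riesz \<gamma> p"
  using assms by (auto simp: riesz_def polys_def intro!: sum.cong)

text \<open>The values \<open>mono_eval m z\<close> are the moments of the point mass at
  \<open>z\<close>, so evaluation inherits the linearity of the Riesz functional.\<close>

lemma poly_eval_riesz: "poly_eval p z = riesz (\<lambda>m. mono_eval m z) p"
  by (simp add: poly_eval_def riesz_def)

lemma mono_eval_add: "mono_eval (a + b) z = mono_eval a z * mono_eval b z"
  by (simp add: mono_eval_def power_add prod.distrib)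

lemma poly_eval_single_mult:
  "poly_eval (Poly_Mapping.single e a * p) z = a * mono_eval e z * poly_eval p z"
  by (simp add: poly_eval_riesz riesz_single_mult mono_eval_add)
     (simp add: riesz_def sum_distrib_left mult_ac)

section \<open>The kernel of a moment matrix\<close>

definition mker :: "nat \<Rightarrow> ('d::finite mono \<Rightarrow> complex) \<Rightarrow> 'd::finite cpoly set" where
  "mker l \<gamma> = {p \<in> polys l. \<forall>g\<in>polys l. riesz \<gamma> (p * g) = 0}"

lemma sum_fun_apply: "(\<Sum>i\<in>I. f i) x = (\<Sum>i\<in>I. f i x)"
  for f :: "'i \<Rightarrow> 'b \<Rightarrow> 'c::comm_monoid_add"
  by (induction I rule: infinite_finite_induct) simp_all

lemma poly_col_moment_matrix:
  assumes "p \<in> polys l" "r \<in> monoms l"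
  shows "poly_col l (moment_matrix l \<gamma>) p r = riesz \<gamma> (p * Poly_Mapping.single (prod.swap r) 1)"
proof -
  have "riesz \<gamma> (p * Poly_Mapping.single (prod.swap r) 1) =
      riesz \<gamma> (\<Sum>c\<in>monoms l. Poly_Mapping.single (c + prod.swap r) (Poly_Mapping.lookup p c))"
    by (subst poly_expansion[OF assms(1)]) (simp add: sum_distrib_right mult_single)
  also have "\<dots> = (\<Sum>c\<in>monoms l. Poly_Mapping.lookup p c * \<gamma> (c + prod.swap r))"
    by (simp add: riesz_sum riesz_single)
  also have "\<dots> = (\<Sum>c\<in>monoms l. Poly_Mapping.lookup p c * moment_matrix l \<gamma> r c)"
    using assms(2) by (intro sum.cong) (auto simp: moment_matrix_entry)
  finally show ?thesis
    by (simp add: poly_col_def sum_fun_apply fscale_def col_def)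
qed

lemma poly_col_outside: "r \<notin> monoms l \<Longrightarrow> poly_col l (moment_matrix l \<gamma>) p r = 0"
  by (simp add: poly_col_def sum_fun_apply fscale_def col_def moment_matrix_def)

text \<open>Row \<open>r\<close> tests \<open>p\<close> against the conjugate monomial
  \<open>prod.swap r\<close>. As swapping permutes \<open>monoms l\<close>, all rows together test
  \<open>p\<close> against every monomial of degree at most \<open>l\<close>, hence by linearity
  against all of \<open>polys l\<close>; no conjugation is left.\<close>

lemma poly_col_eq_0_iff:
  assumes "p \<in> polys l"
  shows "poly_col l (moment_matrix l \<gamma>) p = 0 \<longleftrightarrow> p \<in> mker l \<gamma>"
proof
  assume "p \<in> mker l \<gamma>"
  then show "poly_col l (moment_matrix l \<gamma>) p = 0"
    by (intro ext, case_tac "x \<in> monoms l")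
       (auto simp: mker_def poly_col_moment_matrix poly_col_outside single_in_polys
         monoms_def mdeg_swap)
next
  assume zero: "poly_col l (moment_matrix l \<gamma>) p = 0"
  have mono: "riesz \<gamma> (p * Poly_Mapping.single m 1) = 0" if "m \<in> monoms l" for m
    using poly_col_moment_matrix[OF assms, of "prod.swap m" \<gamma>] that zero
    by (simp add: monoms_def mdeg_swap)
  have "riesz \<gamma> (p * g) = 0" if "g \<in> polys l" for g
  proof -
    have "p * g = (\<Sum>c\<in>monoms l.
        Poly_Mapping.single 0 (Poly_Mapping.lookup g c) * (p * Poly_Mapping.single c 1))"
      by (subst poly_expansion[OF that])
         (simp add: sum_distrib_left mult.left_commute[of _ p] mult_single)
    then show ?thesis by (simp add: riesz_sum riesz_scale mono)
  qed
  then show "p \<in> mker l \<gamma>" using assms by (simp add: mker_def)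
qed

lemma variety_eq: "variety l (moment_matrix l \<gamma>) = {z. \<forall>p\<in>mker l \<gamma>. poly_eval p z = 0}"
proof -
  have "mker l \<gamma> \<subseteq> polys l" by (auto simp: mker_def)
  then have "mker l \<gamma> = {p \<in> polys l. poly_col l (moment_matrix l \<gamma>) p = 0}"
    using poly_col_eq_0_iff by blast
  then show ?thesis unfolding variety_def zero_set_def by blast
qed

lemma mker_diff: "p \<in> mker l \<gamma> \<Longrightarrow> q \<in> mker l \<gamma> \<Longrightarrow> p - q \<in> mker l \<gamma>"
  by (simp add: mker_def polys_diff left_diff_distrib riesz_diff)

lemma mker_scale: "p \<in> mker l \<gamma> \<Longrightarrow> Poly_Mapping.single 0 a * p \<in> mker l \<gamma>"
  by (simp add: mker_def polys_scale mult.assoc riesz_scale)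

lemma mker_sum: "(\<And>i. i \<in> I \<Longrightarrow> f i \<in> mker l \<gamma>) \<Longrightarrow> (\<Sum>i\<in>I. f i) \<in> mker l \<gamma>"
  by (simp add: mker_def polys_sum sum_distrib_right riesz_sum)

text \<open>Products of two polynomials of degree at most \<open>l\<close> see only the moments on
  which both sequences agree.\<close>

lemma mker_restrict:
  assumes "\<And>m. m \<in> monoms (2 * l) \<Longrightarrow> \<gamma>' m = \<gamma> m" "p \<in> mker k \<gamma>'" "p \<in> polys l" "l \<le> k"
  shows "p \<in> mker l \<gamma>"
proof -
  have "riesz \<gamma> (p * g) = 0" if "g \<in> polys l" for g
  proof -
    have "p * g \<in> polys (2 * l)" using polys_mult[OF assms(3) that] by (simp add: mult_2)
    then have "riesz \<gamma> (p * g) = riesz \<gamma>' (p * g)"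
      using riesz_cong assms(1) by metis
    then show ?thesis
      using assms(2,4) polys_mono[OF that] by (simp add: mker_def)
  qed
  then show ?thesis using assms(3) by (simp add: mker_def)
qed

section \<open>Dimensions of spans of finite sets\<close>

lemma (in vector_space) span_eq_of_dim_eq:
  assumes "finite S" "T \<subseteq> span S" "dim T = dim S"
  shows "span T = span S"
proof -
  obtain B where B: "B \<subseteq> T" "independent B" "T \<subseteq> span B" "card B = dim T"
    using basis_exists by blast
  obtain C where C: "C \<subseteq> S" "independent C" "S \<subseteq> span C" "card C = dim S"
    using basis_exists by blast
  have fin: "finite C" using C(1) assms(1) finite_subset by blast
  have SC: "span S \<subseteq> span C" using C(3) by (simp add: span_minimal)
  \<comment> \<open>A vector of \<open>S\<close> outside \<open>span B\<close> would enlarge the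
    basis of \<open>T\<close> to an independent set of \<open>dim S + 1\<close> vectors inside
    \<open>span S\<close>.\<close>
  have "S \<subseteq> span B"
  proof (rule ccontr)
    assume "\<not> S \<subseteq> span B"
    then obtain x where x: "x \<in> S" "x \<notin> span B" by blast
    then have "independent (insert x B)" "x \<notin> B"
      using B(2) by (auto simp: independent_insert span_base)
    have "insert x B \<subseteq> span C"
      using x(1) B(1) C(3) assms(2) SC by blast
    with \<open>independent (insert x B)\<close> have "finite (insert x B) \<and> card (insert x B) \<le> card C"
      by (rule independent_span_bound[OF fin])
    then show False using \<open>x \<notin> B\<close> B(4) C(4) assms(3) by auto
  qed
  then have "S \<subseteq> span T" using B(1) span_mono by blast
  then show ?thesis using assms(2) by (simp add: span_minimal subset_antisym)
qed

text \<open>The columns live in an infinite-dimensional function space, and \<open>dim\<close> is 0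
  when a basis is infinite; finiteness of \<open>S\<close> is what makes monotonicity true.\<close>

lemma (in vector_space) dim_mono_finite:
  assumes "finite S" "T \<subseteq> span S"
  shows "dim T \<le> dim S"
proof -
  obtain B where B: "B \<subseteq> T" "independent B" "T \<subseteq> span B" "card B = dim T"
    using basis_exists by blast
  obtain C where C: "C \<subseteq> S" "independent C" "S \<subseteq> span C" "card C = dim S"
    using basis_exists by blast
  have "finite C" using C(1) assms(1) finite_subset by blast
  moreover have "B \<subseteq> span C"
    using B(1) assms(2) span_minimal[OF C(3) subspace_span] by blast
  ultimately show ?thesis
    using independent_span_bound[of C B] B C by simp
qed

lemma (in vector_space) dim_image_le_finite:
  assumes "module_hom scale scale f" "finite S"
  shows "dim (f ` S) \<le> dim S"
proof -
  interpret f: module_hom scale scale f by fact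
  obtain C where C: "C \<subseteq> S" "independent C" "S \<subseteq> span C" "card C = dim S"
    using basis_exists by blast
  have fin: "finite C" using C(1) assms(2) finite_subset by blast
  have "f ` S \<subseteq> span (f ` C)" using C(3) by (auto simp: f.span_image)
  then have "dim (f ` S) \<le> card (f ` C)"
    by (rule dim_le_card) (simp add: fin)
  also have "\<dots> \<le> card C" by (rule card_image_le[OF fin])
  finally show ?thesis using C(4) by simp
qed

section \<open>Column spaces and the kernels of flat extensions\<close>

lemma poly_col_single:
  "m \<in> monoms l \<Longrightarrow> poly_col l A (Poly_Mapping.single m 1) = col A m"
  by (simp add: poly_col_def lookup_single when_def fscale_def fun_eq_iff sum_fun_apply
      if_distrib if_distribR cong: if_cong)

lemma poly_col_add: "poly_col l A (p + q) = poly_col l A p + poly_col l A q"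
  by (simp add: poly_col_def lookup_add cfun.scale_left_distrib sum.distrib)

lemma poly_col_diff: "poly_col l A (p - q) = poly_col l A p - poly_col l A q"
  using poly_col_add[of l A "p - q" q] by simp

lemma lookup_scale:
  "Poly_Mapping.lookup (Poly_Mapping.single 0 a * p) m = a * Poly_Mapping.lookup (p :: 'd::finite cpoly) m"
proof -
  have "Poly_Mapping.single 0 a * p = Poly_Mapping.map ((*) a) p"
    by (simp add: mult_map_scale_conv_mult)
  then show ?thesis by (simp add: Poly_Mapping.map.rep_eq when_def)
qed

lemma poly_col_scale:
  "poly_col l A (Poly_Mapping.single 0 a * p) = fscale a (poly_col l A p)"
  by (simp add: poly_col_def lookup_scale cfun.scale_sum_right)

lemma subspace_poly_cols: "cfun.subspace (poly_col l A ` polys k)"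
  unfolding cfun.subspace_def
proof (intro conjI ballI allI)
  show "0 \<in> poly_col l A ` polys k"
    by (rule image_eqI[of _ _ 0]) (simp_all add: poly_col_def)
qed (auto simp: poly_col_add[symmetric] poly_col_scale[symmetric] polys_add polys_scale)

lemma span_cols_subset: "k \<le> l \<Longrightarrow> cfun.span (col A ` monoms k) \<subseteq> poly_col l A ` polys k"
proof (rule cfun.span_minimal[OF _ subspace_poly_cols])
  assume "k \<le> l"
  then have "m \<in> monoms l" if "m \<in> monoms k" for m :: "'a mono"
    using that by (simp add: monoms_def)
  then show "col A ` monoms k \<subseteq> poly_col l A ` polys k"
    by (metis image_eqI image_subsetI poly_col_single single_in_polys)
qed

text \<open>Cutting the columns of degree at most \<open>l\<close> of the larger matrix down to rows
  of degree at most \<open>l\<close> gives the columns of the smaller one. Hence these columns have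
  dimension at least the rank of the smaller matrix, which by flatness is the rank of the larger
  one, so they span its whole column space.\<close>

lemma flat_reduction:
  fixes \<gamma> \<gamma>' :: "'d::finite mono \<Rightarrow> complex"
  assumes "flat_extension l \<gamma> \<gamma>'" "m \<in> monoms (l + 1)"
  obtains q where "q \<in> polys l" "Poly_Mapping.single m 1 - q \<in> mker (l + 1) \<gamma>'"
proof -
  let ?A = "moment_matrix l \<gamma>" and ?B = "moment_matrix (l + 1) \<gamma>'"
  let ?S = "col ?B ` monoms (l + 1)" and ?T = "col ?B ` monoms l"
  \<comment> \<open>Filling the removed rows with zeros matches the convention that
    \<open>moment_matrix l\<close> vanishes outside \<open>monoms l\<close>.\<close>
  define R :: "('d mono \<Rightarrow> complex) \<Rightarrow> 'd mono \<Rightarrow> complex"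
    where "R = (\<lambda>f r. if r \<in> monoms l then f r else 0)"
  have R: "module_hom fscale fscale R"
    by unfold_locales (auto simp: R_def fscale_def fun_eq_iff)
  have sub: "r \<in> monoms (l + 1)" if "r \<in> monoms l" for r :: "'d mono"
    using that by (simp add: monoms_def)
  have ext: "\<gamma>' (c + prod.swap r) = \<gamma> (c + prod.swap r)"
    if "r \<in> monoms l" "c \<in> monoms l" for r c
  proof -
    have "c + prod.swap r \<in> monoms (2 * l)"
      using that by (simp add: monoms_def mdeg_add mdeg_swap)
    then show ?thesis using assms(1) unfolding flat_extension_def by blast
  qed
  have "R (col ?B c) = col ?A c" if "c \<in> monoms l" for c
  proof
    fix r
    show "R (col ?B c) r = col ?A c r"
    proof (cases "r \<in> monoms l")
      case True
      then show ?thesis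
        using that sub[OF True] sub[OF that]
        by (simp add: R_def col_def moment_matrix_entry ext del: add_Suc_right One_nat_def)
    next
      case False
      then show ?thesis by (simp add: R_def col_def moment_matrix_def)
    qed
  qed
  then have "R ` ?T = col ?A ` monoms l"
    by (simp add: image_image)
  then have "cfun.dim (col ?A ` monoms l) \<le> cfun.dim ?T"
    using cfun.dim_image_le_finite[OF R, of ?T] by simp
  moreover have TS: "?T \<subseteq> cfun.span ?S"
    using sub by (auto intro: cfun.span_base)
  then have "cfun.dim ?T \<le> cfun.dim ?S"
    by (intro cfun.dim_mono_finite) auto
  moreover have "cfun.dim ?S = cfun.dim (col ?A ` monoms l)"
    using assms(1) by (simp add: flat_extension_def mrank_def)
  ultimately have "cfun.span ?T = cfun.span ?S"
    using TS by (intro cfun.span_eq_of_dim_eq) auto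
  then have "col ?B m \<in> cfun.span ?T"
    using assms(2) by (simp add: cfun.span_base)
  then obtain q where q: "q \<in> polys l" "col ?B m = poly_col (l + 1) ?B q"
    using span_cols_subset[of l "l + 1" ?B] by auto
  have "poly_col (l + 1) ?B (Poly_Mapping.single m 1 - q) = 0"
    using q(2) by (simp only: poly_col_diff poly_col_single[OF assms(2)] diff_self)
  moreover have "Poly_Mapping.single m 1 - q \<in> polys (l + 1)"
    using assms(2) polys_mono[OF q(1)] by (simp add: polys_diff single_in_polys)
  ultimately show ?thesis
    using that q(1) poly_col_eq_0_iff by blast
qed

text \<open>The reductions of the monomials extend linearly.\<close>

lemma flat_reduction_poly:
  assumes "flat_extension l \<gamma> \<gamma>'" "p \<in> polys (l + 1)"
  obtains q where "q \<in> polys l" "p - q \<in> mker (l + 1) \<gamma>'"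
proof -
  have "\<forall>m\<in>monoms (l + 1). \<exists>q. q \<in> polys l \<and> Poly_Mapping.single m 1 - q \<in> mker (l + 1) \<gamma>'"
    using flat_reduction[OF assms(1)] by metis
  then obtain Q where Q: "\<And>m. m \<in> monoms (l + 1) \<Longrightarrow>
      Q m \<in> polys l \<and> Poly_Mapping.single m 1 - Q m \<in> mker (l + 1) \<gamma>'"
    by metis
  let ?s = "\<lambda>m. Poly_Mapping.single 0 (Poly_Mapping.lookup p m)"
  have "p - (\<Sum>m\<in>monoms (l + 1). ?s m * Q m) =
      (\<Sum>m\<in>monoms (l + 1). ?s m * (Poly_Mapping.single m 1 - Q m))"
    by (subst (1) poly_expansion[OF assms(2)])
       (simp add: right_diff_distrib mult_single sum_subtractf)
  also have "\<dots> \<in> mker (l + 1) \<gamma>'"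
    using Q by (intro mker_sum mker_scale) blast
  finally show ?thesis
    using Q by (intro that[of "\<Sum>m\<in>monoms (l + 1). ?s m * Q m"] polys_sum polys_scale) auto
qed

text \<open>A test polynomial \<open>g\<close> splits as \<open>q + (g - q)\<close>: the part
  \<open>q\<close> is killed because \<open>p\<close> lies in the smaller kernel, and
  \<open>g - q\<close> lies in the larger kernel, for which \<open>p\<close> is itself an admissible
  test polynomial.\<close>

lemma mker_flat_subset:
  assumes "flat_extension l \<gamma> \<gamma>'" "p \<in> mker l \<gamma>"
  shows "p \<in> mker (l + 1) \<gamma>'"
proof -
  have p: "p \<in> polys l" using assms(2) by (simp add: mker_def)
  have p': "p \<in> polys (l + 1)" using polys_mono[OF p] by simp
  have "riesz \<gamma>' (p * g) = 0" if "g \<in> polys (l + 1)" for g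
  proof -
    obtain q where q: "q \<in> polys l" "g - q \<in> mker (l + 1) \<gamma>'"
      using flat_reduction_poly[OF assms(1) \<open>g \<in> polys (l + 1)\<close>] .
    have "p * q \<in> polys (2 * l)" using polys_mult[OF p q(1)] by (simp add: mult_2)
    then have "riesz \<gamma>' (p * q) = riesz \<gamma> (p * q)"
      using assms(1) by (intro riesz_cong[of "2 * l"]) (auto simp: flat_extension_def)
    moreover have "riesz \<gamma> (p * q) = 0" using assms(2) q(1) by (simp add: mker_def)
    moreover have "riesz \<gamma>' ((g - q) * p) = 0" using q(2) p' by (simp add: mker_def)
    moreover have "riesz \<gamma>' (p * g) = riesz \<gamma>' (p * q) + riesz \<gamma>' ((g - q) * p)"
      by (simp add: riesz_add[symmetric] algebra_simps)
    ultimately show ?thesis by simp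
  qed
  then show ?thesis using p' by (simp add: mker_def)
qed

text \<open>Moving \<open>x\<close> over to \<open>g\<close> directly could produce degree
  \<open>l + 2\<close>, too large to test \<open>p\<close>. Reducing \<open>g\<close> to
  \<open>q\<close> of degree at most \<open>l\<close> first keeps \<open>x * q\<close> within degree
  \<open>l + 1\<close>.\<close>

lemma mker_flat_mult:
  assumes "flat_extension l \<gamma> \<gamma>'" "p \<in> mker l \<gamma>" "x \<in> polys 1"
  shows "x * p \<in> mker (l + 1) \<gamma>'"
proof -
  have xp: "x * p \<in> polys (l + 1)"
    using polys_mult[OF assms(3), of p l] assms(2) by (simp add: mker_def)
  have "riesz \<gamma>' (x * p * g) = 0" if "g \<in> polys (l + 1)" for g
  proof -
    obtain q where q: "q \<in> polys l" "g - q \<in> mker (l + 1) \<gamma>'"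
      using flat_reduction_poly[OF assms(1) \<open>g \<in> polys (l + 1)\<close>] .
    have "x * q \<in> polys (l + 1)" using polys_mult[OF assms(3) q(1)] by simp
    then have "riesz \<gamma>' (p * (x * q)) = 0"
      using mker_flat_subset[OF assms(1,2)] by (simp add: mker_def)
    moreover have "riesz \<gamma>' ((g - q) * (x * p)) = 0" using q(2) xp by (simp add: mker_def)
    moreover have "riesz \<gamma>' (x * p * g) = riesz \<gamma>' (p * (x * q)) + riesz \<gamma>' ((g - q) * (x * p))"
      by (simp add: riesz_add[symmetric] algebra_simps)
    ultimately show ?thesis by simp
  qed
  then show ?thesis using xp by (simp add: mker_def)
qed

section \<open>Factoring monomials and comparing the varieties\<close>

lemma mono_split:
  fixes m :: "'d::finite mono"
  assumes "mdeg m = Suc l"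
  obtains e m' where "m = e + m'" "mdeg e = 1" "mdeg m' = l"
proof -
  obtain i j where m: "m = (i, j)" by (cases m)
  \<comment> \<open>Subtraction of naturals loses nothing here, as entry \<open>k\<close> is
    positive.\<close>
  have axis: "v = axis k 1 + (v - axis k 1)" if "v $ k \<noteq> 0" for v :: "nat ^ 'd" and k
    using that by (simp add: vec_eq_iff axis_def)
  have deg: "(\<Sum>k'\<in>UNIV. axis k (1::nat) $ k') = 1" for k :: 'd
    by (simp add: axis_def)
  have "\<exists>e m'. m = e + m' \<and> mdeg e = 1"
  proof (cases "\<exists>k. i $ k \<noteq> 0")
    case True
    then obtain k where "i $ k \<noteq> 0" by blast
    then have "m = (axis k 1, 0) + (i - axis k 1, j)" using axis m by simp
    moreover have "mdeg (axis k 1, 0 :: nat ^ 'd) = 1" using deg by (simp add: mdeg_def)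
    ultimately show ?thesis by blast
  next
    case False
    then have "(\<Sum>k\<in>UNIV. j $ k) \<noteq> 0" using assms m by (simp add: mdeg_def)
    then obtain k where "j $ k \<noteq> 0" by (metis sum.neutral)
    then have "m = (0, axis k 1) + (i, j - axis k 1)" using axis m by simp
    moreover have "mdeg (0 :: nat ^ 'd, axis k 1) = 1" using deg by (simp add: mdeg_def)
    ultimately show ?thesis by blast
  qed
  then obtain e m' where "m = e + m'" "mdeg e = 1" by blast
  moreover from this have "mdeg m' = l" using assms by (simp add: mdeg_add)
  ultimately show ?thesis by (rule that)
qed

lemma poly_eval_diff: "poly_eval (p - q) z = poly_eval p z - poly_eval q z"
  by (simp add: poly_eval_riesz riesz_diff)

theorem theorem2p4:
  fixes \<gamma> \<gamma>1 \<gamma>2 :: "'d::finite mono \<Rightarrow> complex" and n :: nat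
  assumes "psd n (moment_matrix n \<gamma>)"
    and "flat_extension n \<gamma> \<gamma>1"
    and "flat_extension (n + 1) \<gamma>1 \<gamma>2"
  shows "variety (n + 2) (moment_matrix (n + 2) \<gamma>2) = variety (n + 1) (moment_matrix (n + 1) \<gamma>1)"
proof -
  have n2: "n + 1 + 1 = n + 2" by simp
  \<comment> \<open>A larger kernel imposes more equations, so this gives the inclusion of
    \<open>variety (n + 2)\<close> in \<open>variety (n + 1)\<close>.\<close>
  have sub: "p \<in> mker (n + 2) \<gamma>2" if "p \<in> mker (n + 1) \<gamma>1" for p
    using mker_flat_subset[OF assms(3) that] by (simp only: n2)
  have "poly_eval p z = 0"
    if z: "\<forall>p\<in>mker (n + 1) \<gamma>1. poly_eval p z = 0" and p: "p \<in> mker (n + 2) \<gamma>2" for p z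
  proof -
    \<comment> \<open>With \<open>z\<close> fixed, \<open>J\<close> collects the errors allowed in a
      reduction: they stay in the kernel and do not change the value at \<open>z\<close>.\<close>
    define J where "J = {f \<in> mker (n + 2) \<gamma>2. poly_eval f z = 0}"
    have red: "\<exists>q\<in>polys (n + 1). Poly_Mapping.single m 1 - q \<in> J" if "m \<in> monoms (n + 2)" for m
    proof (cases "mdeg m \<le> n + 1")
      case True
      then show ?thesis
        by (intro bexI[of _ "Poly_Mapping.single m 1"])
           (simp_all add: J_def mker_def poly_eval_def single_in_polys monoms_def)
    next
      case False
      then have "mdeg m = Suc (n + 1)" using that by (simp add: monoms_def)
      then obtain e m' where m: "m = e + m'" "mdeg e = 1" "mdeg m' = n + 1"
        using mono_split by blast
      then have "m' \<in> monoms (n + 1)" by (simp add: monoms_def)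
      \<comment> \<open>Using the first flat extension brings \<open>q\<close> down to degree
        \<open>n\<close>, so multiplying by the variable \<open>e\<close> still leaves degree at
        most \<open>n + 1\<close>.\<close>
      then obtain q where q: "q \<in> polys n" "Poly_Mapping.single m' 1 - q \<in> mker (n + 1) \<gamma>1"
        using flat_reduction[OF assms(2)] by blast
      let ?x = "Poly_Mapping.single e 1 :: 'd cpoly"
      have x: "?x \<in> polys 1" using m(2) by (simp add: single_in_polys monoms_def)
      \<comment> \<open>The second flat extension puts the product in the kernel; it vanishes at
        \<open>z\<close> because its second factor does.\<close>
      have "?x * (Poly_Mapping.single m' 1 - q) \<in> J"
        using mker_flat_mult[OF assms(3) q(2) x] z q(2)
        by (simp add: J_def poly_eval_single_mult)
      moreover have "?x * (Poly_Mapping.single m' 1 - q) = Poly_Mapping.single m 1 - ?x * q"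
        by (simp add: right_diff_distrib mult_single m(1))
      ultimately show ?thesis
        using polys_mult[OF x q(1)] by auto
    qed
    then obtain Q where Q: "\<And>m. m \<in> monoms (n + 2) \<Longrightarrow>
        Q m \<in> polys (n + 1) \<and> Poly_Mapping.single m 1 - Q m \<in> J"
      by metis
    let ?s = "\<lambda>m. Poly_Mapping.single 0 (Poly_Mapping.lookup p m)"
    define q where "q = (\<Sum>m\<in>monoms (n + 2). ?s m * Q m)"
    have "p \<in> polys (n + 2)" using p by (simp add: mker_def)
    then have "p - q = (\<Sum>m\<in>monoms (n + 2). ?s m * (Poly_Mapping.single m 1 - Q m))"
      unfolding q_def by (subst (1) poly_expansion, assumption)
         (simp add: right_diff_distrib mult_single sum_subtractf)
    moreover have "?s m * (Poly_Mapping.single m 1 - Q m) \<in> J" if "m \<in> monoms (n + 2)" for m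
      using Q[OF that] by (simp add: J_def mker_scale poly_eval_single_mult)
    ultimately have pq: "p - q \<in> mker (n + 2) \<gamma>2" "poly_eval (p - q) z = 0"
      by (auto simp: J_def poly_eval_riesz riesz_sum intro!: mker_sum sum.neutral)
    \<comment> \<open>As \<open>q\<close> also has degree at most \<open>n + 1\<close>, it descends
      to the kernel of the smaller matrix and vanishes at \<open>z\<close>; \<open>p\<close> has the
      same value there.\<close>
    have "q \<in> mker (n + 2) \<gamma>2" using mker_diff[OF p pq(1)] by simp
    moreover have "q \<in> polys (n + 1)" unfolding q_def using Q by (intro polys_sum polys_scale) blast
    ultimately have "q \<in> mker (n + 1) \<gamma>1"
      using assms(3) by (intro mker_restrict[of "n + 1" \<gamma>2 \<gamma>1 q "n + 2"]) (auto simp: flat_extension_def)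
    then show ?thesis using z pq(2) by (simp add: poly_eval_diff)
  qed
  then show ?thesis using sub by (auto simp: variety_eq)
qed

end
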